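(* Let $\mathbf{R}=\langle R,+,\cdot,0,1,\alpha\rangle$ be an integral involutive near semiring. An element $e\in R$ is central if and only if it satisfies the following equations for all $x,y,z,u\in R$: 1. $(e\cdot\alpha(x))+(\alpha(e)\cdot\alpha(y))=\alpha\big((e\cdot x)+(\alpha(e)\cdot y)\big)$; 2. $(e\cdot(x\cdot z))+(\alpha(e)\cdot(y\cdot u))=\big((e\cdot x)+(\alpha(e)\cdot y)\big)\cdot\big((e\cdot z)+(\alpha(e)\cdot u)\big)$.
   Context: A near semiring is an algebra $\langle R,+,\cdot,0,1\rangle$ such that: (i) $\langle R,+,0\rangle$ is a commutative monoid; (ii) $x\cdot 1=x=1\cdot x$ (multiplication need not be associative or commutative); (iii) $(x+y)\cdot z=(x\cdot z)+(y\cdot z)$; (iv) $x\cdot 0=0\cdot x=0$. It is idempotent if $x+x=x$; then $x\le y$ iff $x+y=y$ defines a partial order, called the induced order. It is integral if $x+1=1$ for all $x$. An involutive near semiring is an idempotent near semiring with a map $\alpha:R\to R$ such that $\alpha(\alpha(x))=x$, and $x\le y$ implies $\alpha(y)\le\alpha(x)$. For $a,b\in R$, $\theta(a,b)$ denotes the congruence of $\mathbf{R}$ (with respect to $+,\cdot,\alpha,0,1$) generated by the pair $(a,b)$. An element $e\in R$ is central if $(\theta(e,0),\theta(e,1))$ is a pair of complementary factor congruences of $\mathbf{R}$, i.e. $\theta(e,0)\cap\theta(e,1)$ is the identity relation and $\theta(e,0)\circ\theta(e,1)=R\times R$. *)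

theory Defs
  imports Main
begin

(* Multiplication is not assumed associative or commutative, and only right
   distributivity holds; hence the library's semiring classes do not apply.
   Annihilation by 0 comes from mult_zero, and 0 = 1 is not excluded. *)
class near_semiring = comm_monoid_add + mult_zero + one +
  assumes near_mult_1_left: "1 * x = x"
    and near_mult_1_right: "x * 1 = x"
    and near_distrib_right: "(x + y) * z = x * z + y * z"

class idempotent_near_semiring = near_semiring +
  assumes near_add_idem: "x + x = x"
begin

definition induced_le :: "'a \<Rightarrow> 'a \<Rightarrow> bool"  (infix "\<sqsubseteq>" 50)
  where "x \<sqsubseteq> y \<longleftrightarrow> x + y = y"

end

class involutive_near_semiring = idempotent_near_semiring +
  fixes \<alpha> :: "'a \<Rightarrow> 'a"
  assumes alpha_invol: "\<alpha> (\<alpha> x) = x"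
    and alpha_antitone: "x \<sqsubseteq> y \<Longrightarrow> \<alpha> y \<sqsubseteq> \<alpha> x"

class integral_involutive_near_semiring = involutive_near_semiring +
  assumes add_1_integral: "x + 1 = 1"

context involutive_near_semiring
begin

definition congruence :: "('a \<times> 'a) set \<Rightarrow> bool"
  where "congruence C \<longleftrightarrow>
    equiv UNIV C \<and>
    (\<forall>x x' y y'. (x, x') \<in> C \<longrightarrow> (y, y') \<in> C \<longrightarrow> (x + y, x' + y') \<in> C) \<and>
    (\<forall>x x' y y'. (x, x') \<in> C \<longrightarrow> (y, y') \<in> C \<longrightarrow> (x * y, x' * y') \<in> C) \<and>
    (\<forall>x x'. (x, x') \<in> C \<longrightarrow> (\<alpha> x, \<alpha> x') \<in> C)"

definition principal_congruence :: "'a \<Rightarrow> 'a \<Rightarrow> ('a \<times> 'a) set"  ("\<theta>")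
  where "\<theta> a b = \<Inter> {C. congruence C \<and> (a, b) \<in> C}"

definition complementary_factor_congruences ::
    "('a \<times> 'a) set \<Rightarrow> ('a \<times> 'a) set \<Rightarrow> bool"
  where "complementary_factor_congruences C D \<longleftrightarrow>
    congruence C \<and> congruence D \<and> C \<inter> D = Id \<and> C O D = UNIV"

definition central :: "'a \<Rightarrow> bool"
  where "central e \<longleftrightarrow> complementary_factor_congruences (\<theta> e 0) (\<theta> e 1)"

lemma congruence_principal_congruence: "congruence (\<theta> a b)"
  unfolding congruence_def
proof (intro conjI)
  show "equiv UNIV (\<theta> a b)"
  proof (rule equivI)
    show "refl (\<theta> a b)"
      by (auto simp: principal_congruence_def congruence_def equiv_def refl_on_def)
    show "sym (\<theta> a b)"
      by (rule symI) (auto simp: principal_congruence_def congruence_def equiv_def dest: symD)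
    show "trans (\<theta> a b)"
      by (rule transI) (auto simp: principal_congruence_def congruence_def equiv_def dest: transD)
  qed simp
qed (simp_all add: principal_congruence_def congruence_def)

lemma mem_principal_congruence: "(a, b) \<in> \<theta> a b"
  unfolding principal_congruence_def by blast

lemma principal_congruence_least: "congruence C \<Longrightarrow> (a, b) \<in> C \<Longrightarrow> \<theta> a b \<subseteq> C"
  unfolding principal_congruence_def by blast

end

end

theory Submission
  imports Defs
begin

text \<open>
  The term \<open>e x + \<alpha>(e) y\<close> reduces to \<open>x\<close> modulo \<open>\<theta>(e,1)\<close> and to \<open>y\<close> modulo \<open>\<theta>(e,0)\<close>. Hence
  for central \<open>e\<close> the two sides of each identity agree modulo both congruences, so they are equal.
  Conversely, specialising the identities at \<open>0\<close> and \<open>1\<close> gives \<open>e + \<alpha>(e) = 1\<close> and \<open>x e = e x\<close>;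
  the commutation supplies the missing left distributivity, and the maps \<open>x \<mapsto> e x\<close> and
  \<open>x \<mapsto> \<alpha>(e) x\<close> turn out to have congruences as kernels. These kernels contain
  \<open>\<theta>(e,1)\<close> and \<open>\<theta>(e,0)\<close>, and meet in the identity because \<open>x = e x + \<alpha>(e) x\<close>.
\<close>

text \<open>Flipping \<open>0 \<sqsubseteq> \<alpha> 1\<close> puts \<open>1\<close> below
  \<open>\<alpha> 0\<close>, and integrality makes \<open>1\<close> the top element.\<close>

lemma alpha_0: "\<alpha> (0 :: 'a :: integral_involutive_near_semiring) = 1"
proof -
  have "0 \<sqsubseteq> \<alpha> (1 :: 'a)"
    by (simp add: induced_le_def)
  from alpha_antitone[OF this] have "1 + \<alpha> 0 = \<alpha> (0 :: 'a)"
    by (simp add: alpha_invol induced_le_def)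
  then show ?thesis
    using add_1_integral[of "\<alpha> (0 :: 'a)"] by (simp add: add.commute)
qed

lemma alpha_1: "\<alpha> (1 :: 'a :: integral_involutive_near_semiring) = 0"
  using alpha_0 alpha_invol by metis

context
  fixes C :: "('a :: involutive_near_semiring \<times> 'a) set"
  assumes C: "congruence C"
begin

lemma congruence_refl: "(x, x) \<in> C"
  using C by (auto simp: congruence_def equiv_def refl_on_def)

lemma congruence_sym: "(x, y) \<in> C \<Longrightarrow> (y, x) \<in> C"
  using C by (auto simp: congruence_def equiv_def dest: symD)

lemma congruence_trans: "(x, y) \<in> C \<Longrightarrow> (y, z) \<in> C \<Longrightarrow> (x, z) \<in> C"
  using C by (auto simp: congruence_def equiv_def dest: transD)

lemma congruence_add: "(x, x') \<in> C \<Longrightarrow> (y, y') \<in> C \<Longrightarrow> (x + y, x' + y') \<in> C"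
  using C by (simp add: congruence_def)

lemma congruence_mult: "(x, x') \<in> C \<Longrightarrow> (y, y') \<in> C \<Longrightarrow> (x * y, x' * y') \<in> C"
  using C by (simp add: congruence_def)

lemma congruence_alpha: "(x, x') \<in> C \<Longrightarrow> (\<alpha> x, \<alpha> x') \<in> C"
  using C by (simp add: congruence_def)

lemma congruence_choose_left:
  assumes "(e, 1) \<in> C" "(f, 0) \<in> C"
  shows "(e * x + f * y, x) \<in> C"
  using congruence_add[OF congruence_mult[OF assms(1) congruence_refl[of x]]
      congruence_mult[OF assms(2) congruence_refl[of y]]]
  by (simp add: near_mult_1_left)

lemma congruence_choose_right:
  assumes "(e, 0) \<in> C" "(f, 1) \<in> C"
  shows "(e * x + f * y, y) \<in> C"
  using congruence_choose_left[OF assms(2,1), of y x] by (simp add: add.commute)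

end

text \<open>Applying \<open>\<alpha>\<close> to the pair \<open>(e, 1)\<close> makes
  \<open>\<alpha> e\<close> congruent to \<open>\<alpha> 1 = 0\<close>.\<close>

lemma choose_mod_theta_1:
  fixes e :: "'a :: integral_involutive_near_semiring"
  shows "(e * x + \<alpha> e * y, x) \<in> \<theta> e 1"
  using congruence_choose_left[OF congruence_principal_congruence mem_principal_congruence]
    congruence_alpha[OF congruence_principal_congruence mem_principal_congruence, of e 1]
  by (simp add: alpha_1)

lemma choose_mod_theta_0:
  fixes e :: "'a :: integral_involutive_near_semiring"
  shows "(e * x + \<alpha> e * y, y) \<in> \<theta> e 0"
  using congruence_choose_right[OF congruence_principal_congruence mem_principal_congruence]
    congruence_alpha[OF congruence_principal_congruence mem_principal_congruence, of e 0]
  by (simp add: alpha_0)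

text \<open>The element \<open>e * y + \<alpha> e * x\<close> links \<open>x\<close> to
  \<open>y\<close>. This works for every \<open>e\<close>, so centrality hinges on the intersection
  alone.\<close>

lemma theta_comp_eq_UNIV:
  fixes e :: "'a :: integral_involutive_near_semiring"
  shows "\<theta> e 0 O \<theta> e 1 = UNIV"
proof -
  have "(x, y) \<in> \<theta> e 0 O \<theta> e 1" for x y
    using congruence_sym[OF congruence_principal_congruence choose_mod_theta_0[of e y x]]
      choose_mod_theta_1[of e y x] by (rule relcompI)
  then show ?thesis by auto
qed

lemma central_identities:
  fixes e :: "'a :: integral_involutive_near_semiring"
  assumes "central e"
  shows "e * \<alpha> x + \<alpha> e * \<alpha> y = \<alpha> (e * x + \<alpha> e * y)"
    and "e * (x * z) + \<alpha> e * (y * u) = (e * x + \<alpha> e * y) * (e * z + \<alpha> e * u)"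
proof -
  have eqI: "s = t"
    if "(s, a) \<in> \<theta> e 0" "(t, a) \<in> \<theta> e 0" "(s, b) \<in> \<theta> e 1" "(t, b) \<in> \<theta> e 1" for s t a b :: 'a
  proof -
    have "(s, t) \<in> \<theta> e 0 \<inter> \<theta> e 1"
      using that congruence_trans[OF congruence_principal_congruence]
        congruence_sym[OF congruence_principal_congruence] by blast
    then show ?thesis
      using assms unfolding central_def complementary_factor_congruences_def by blast
  qed
  note cong = congruence_alpha[OF congruence_principal_congruence]
    congruence_mult[OF congruence_principal_congruence]
  show "e * \<alpha> x + \<alpha> e * \<alpha> y = \<alpha> (e * x + \<alpha> e * y)"
    by (rule eqI[OF choose_mod_theta_0 cong(1)[OF choose_mod_theta_0]
      choose_mod_theta_1 cong(1)[OF choose_mod_theta_1]])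
  show "e * (x * z) + \<alpha> e * (y * u) = (e * x + \<alpha> e * y) * (e * z + \<alpha> e * u)"
    by (rule eqI[OF choose_mod_theta_0 cong(2)[OF choose_mod_theta_0 choose_mod_theta_0]
      choose_mod_theta_1 cong(2)[OF choose_mod_theta_1 choose_mod_theta_1]])
qed

text \<open>Commutation with \<open>f\<close> turns right distributivity into left. The condition on
  \<open>\<alpha>\<close> concerns the kernel, since \<open>f * \<alpha> x\<close> generally differs
  from \<open>\<alpha> (f * x)\<close>.\<close>

lemma congruence_kernel_mult:
  fixes f :: "'a :: involutive_near_semiring"
  assumes comm: "\<And>x. f * x = x * f"
    and mult: "\<And>x y. f * (x * y) = (f * x) * (f * y)"
    and alpha: "\<And>x y. f * x = f * y \<Longrightarrow> f * \<alpha> x = f * \<alpha> y"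
  shows "congruence {(x, y). f * x = f * y}"
proof -
  have "f * (x + y) = f * x + f * y" for x y
    by (metis comm near_distrib_right)
  then show ?thesis
    unfolding congruence_def
    by (auto simp: mult intro: alpha intro!: equivI refl_onI symI transI)
qed

context
  fixes e :: "'a :: integral_involutive_near_semiring"
  assumes id_alpha: "\<And>x y. e * \<alpha> x + \<alpha> e * \<alpha> y = \<alpha> (e * x + \<alpha> e * y)"
    and id_mult: "\<And>x y z u.
      e * (x * z) + \<alpha> e * (y * u) = (e * x + \<alpha> e * y) * (e * z + \<alpha> e * u)"
begin

lemma identities_add_eq_1: "e + \<alpha> e = 1"
  using id_alpha[of 0 0] by (simp add: alpha_0 near_mult_1_right)

lemma identities_decompose: "e * x + \<alpha> e * x = x"
  by (metis identities_add_eq_1 near_distrib_right near_mult_1_left)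

lemma identities_commute: "e * x = x * e"
  \<comment> \<open>Positional instantiation of \<open>id_mult\<close> follows the order of
    occurrence \<open>x, z, y, u\<close>; here the right side becomes
    \<open>(e * x + \<alpha> e * x) * e\<close>.\<close>
  using id_mult[of x 1 x 0] by (simp add: near_mult_1_right identities_decompose)

lemma identities_idem: "e * e = e"
  using id_mult[of 1 1 0 0] by (simp add: near_mult_1_right)

lemma identities_kernel: "congruence {(x, y). e * x = e * y}"
proof (rule congruence_kernel_mult)
  show "e * (x * y) = (e * x) * (e * y)" for x y
    using id_mult[of x y 0 0] by simp
  show "e * \<alpha> x = e * \<alpha> y" if "e * x = e * y" for x y
    \<comment> \<open>As \<open>\<alpha> 1 = 0\<close>, this gives
      \<open>e * \<alpha> x = \<alpha> (e * x + \<alpha> e * 1)\<close>, which depends on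
      \<open>x\<close> only through \<open>e * x\<close>.\<close>
    using id_alpha[of x 1] id_alpha[of y 1] that by (simp add: alpha_1)
qed (rule identities_commute)

lemma identities_theta_1: "\<theta> e 1 \<subseteq> {(x, y). e * x = e * y}"
  by (rule principal_congruence_least[OF identities_kernel])
    (simp add: identities_idem near_mult_1_right)

end

lemma central_if_identities:
  fixes e :: "'a :: integral_involutive_near_semiring"
  assumes id_alpha: "\<And>x y. e * \<alpha> x + \<alpha> e * \<alpha> y = \<alpha> (e * x + \<alpha> e * y)"
    and id_mult: "\<And>x y z u.
      e * (x * z) + \<alpha> e * (y * u) = (e * x + \<alpha> e * y) * (e * z + \<alpha> e * u)"
  shows "central e"
proof -
  txt \<open>The identities are symmetric under exchanging \<open>e\<close> and \<open>\<alpha> e\<close>.\<close>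
  have id_alpha': "\<alpha> e * \<alpha> x + \<alpha> (\<alpha> e) * \<alpha> y = \<alpha> (\<alpha> e * x + \<alpha> (\<alpha> e) * y)" for x y
    using id_alpha[of y x] by (simp add: alpha_invol add.commute)
  have id_mult': "\<alpha> e * (x * z) + \<alpha> (\<alpha> e) * (y * u) =
      (\<alpha> e * x + \<alpha> (\<alpha> e) * y) * (\<alpha> e * z + \<alpha> (\<alpha> e) * u)" for x y z u
    using id_mult[of y u x z] by (simp add: alpha_invol add.commute)
  \<comment> \<open>This places \<open>(e, 0)\<close> in the kernel of multiplication by
    \<open>\<alpha> e\<close>.\<close>
  have "\<alpha> e * e = 0"
    using id_mult[of 0 1 1 0] by (simp add: near_mult_1_right)
  then have theta_0: "\<theta> e 0 \<subseteq> {(x, y). \<alpha> e * x = \<alpha> e * y}"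
    by (intro principal_congruence_least identities_kernel[OF id_alpha' id_mult']) simp
  have theta_1: "\<theta> e 1 \<subseteq> {(x, y). e * x = e * y}"
    by (rule identities_theta_1[OF id_alpha id_mult])
  have "x = y" if "(x, y) \<in> \<theta> e 0 \<inter> \<theta> e 1" for x y
  proof -
    have "e * x = e * y" "\<alpha> e * x = \<alpha> e * y"
      using that theta_0 theta_1 by blast+
    then show ?thesis
      by (metis identities_decompose[OF id_alpha id_mult])
  qed
  then have "\<theta> e 0 \<inter> \<theta> e 1 = Id"
    using congruence_refl[OF congruence_principal_congruence] by auto
  then show ?thesis
    by (simp add: central_def complementary_factor_congruences_def
        congruence_principal_congruence theta_comp_eq_UNIV)
qed

theorem theorem14:
  fixes e :: "'a :: integral_involutive_near_semiring"
  shows "central e \<longleftrightarrow>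
    (\<forall>x y z u :: 'a.
      (e * \<alpha> x) + (\<alpha> e * \<alpha> y) = \<alpha> ((e * x) + (\<alpha> e * y)) \<and>
      (e * (x * z)) + (\<alpha> e * (y * u)) =
        ((e * x) + (\<alpha> e * y)) * ((e * z) + (\<alpha> e * u)))"
  using central_identities central_if_identities by blast

end
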